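(* Let $S$ be a semigroup and $C$ a closed convex subset of a real locally convex space $E$ with topological dual $E^*$. Let $G=(V(G),E(G))$ be a directed graph such that $V(G)=C$. Let $\mathcal{B}$ be a base at $0$ for the topology of $E$ consisting of convex, balanced sets, and let $Q=\{q_V: V\in\mathcal{B}\}$, where $q_V$ is the Minkowski functional associated with $V$. Let $\mathcal{S}=\{T_s:s\in S\}$ be a representation of $S$ as $Q$-$G$-nonexpansive mappings from $C$ into itself. Let $X$ be a subspace of $B(S)$ with $1\in X$, and let $\mu$ be a mean on $X$, such that for each $x\in C$ and $x^*\in E^*$ the function $t\mapsto\langle T_tx,x^*\rangle$ is an element of $X$. Write $T_\mu x$ for $\int T_tx\,d\mu(t)$ ($x\in C$). Then the following hold. (i) $T_\mu$ is a $Q$-$G$-nonexpansive mapping from $C$ into $C$. (ii) $T_\mu x=x$ for each $x\in\mathrm{Fix}(\mathcal{S})$. (iii) If moreover $E$ is a real dual locally convex space with real predual locally convex space $D$, $C$ is a $w^*$-closed convex subset of $E$, $U$ is a convex neighbourhood of $0$ in $D$ with associated Minkowski functional $p_U$, and for each $x\in C$ and $z\in D$ the function $t\mapsto\langle z,T_tx\rangle$ is an element of $X$, then $T_\mu x\in\overline{\mathrm{co}\{T_tx:t\in S\}}^{\,w^*}$ for each $x\in C$. (iv) If $X$ is $r_s$-invariant for each $s\in S$ and $\mu$ is right invariant, then $T_\mu T_t=T_\mu$ for each $t\in S$. (v) If $a\in E$ is a $Q$-$G$-attractive point of $\mathcal{S}$ and for each $x\in C$ and $x^*\in E^*$ the function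 $t\mapsto\langle a-T_tx,x^*\rangle$ is an element of $X$, then $a$ is a $Q$-$G$-attractive point of $T_\mu$.
   Context: $B(S)=l^\infty(S)$ is the Banach space of all bounded real-valued functions on $S$ with the supremum norm; $1$ denotes the constant function. For $t\in S$ and $g\in B(S)$, $(r_tg)(s)=g(st)$ for $s\in S$. For a subspace $X$ of $B(S)$ with topological dual $X^*$, a mean on $X$ (with $1\in X$) is an element $\mu\in X^*$ with $\|\mu\|=\mu(1)=1$; $\mu_t(g(t))$ denotes $\mu(g)$. $X$ is $r_s$-invariant if $r_s(X)\subset X$; when this holds for every $s\in S$, $\mu$ is right invariant if $\mu(r_sg)=\mu(g)$ for all $s\in S$, $g\in X$. A representation of $S$ as mappings from $C$ into itself is a family $\mathcal{S}=\{T_s:s\in S\}$ of mappings $T_s:C\to C$ with $T_{st}x=T_sT_tx$ for all $s,t\in S$, $x\in C$; $\mathrm{Fix}(\mathcal{S})=\bigcap_{s\in S}\{x\in C:T_sx=x\}$. For $x\in C$, $T_\mu x=\int T_tx\,d\mu(t)$ denotes the unique element of $E$ satisfying $\langle T_\mu x,x^*\rangle=\mu_t\langle T_tx,x^*\rangle$ for all $x^*\in E^*$; its existence and uniqueness are understood as part of the notation. The Minkowski functional of $V$ is $q_V(x)=\inf\{\lambda>0: x\in\lambda V\}$. A directed graph $G$ with $V(G)=C$ has edge set $E(G)\subseteq C\times C$. A mapping $T:C\to C$ is $Q$-$G$-nonexpansive if $q(Tx-Ty)\le q(x-y)$ for all $q\in Q$ and all $x,y\in C$ with $(x,y)\in E(G)$.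 An element $a\in E$ is a $Q$-$G$-attractive point of $\mathcal{S}$ if $q(a-T_tx)\le q(a-x)$ for all $t\in S$, $x\in C$, $q\in Q$; it is a $Q$-$G$-attractive point of a mapping $T:C\to C$ if $q(a-Tx)\le q(a-x)$ for all $x\in C$, $q\in Q$. "$E$ is a dual locally convex space with predual $D$" means that $E$ is the topological dual of the locally convex space $D$, with pairing $\langle z,e\rangle$ for $z\in D$, $e\in E$; $w^*$ refers to the weak$^*$ topology $\sigma(E,D)$. $\mathrm{co}$ denotes the convex hull. *)

theory Defs
  imports "HOL-Analysis.Analysis" "Graph_Theory.Pair_Digraph"
begin

section \<open>Locally convex spaces\<close>

text \<open>
  No separation axiom is imposed.  The second axiom says that each neighbourhood of \<open>0\<close> contains a
  convex one; \<open>convex\<close> is unfolded because it is not available inside a class specification.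
\<close>

class locally_convex_space = real_vector + topological_ab_group_add +
  assumes tendsto_scaleR_Pair:
      "LIM p (nhds c \<times>\<^sub>F nhds x). fst p *\<^sub>R snd p :> nhds (c *\<^sub>R x)"
    and convex_neighbourhoods:
      "open W \<Longrightarrow> 0 \<in> W \<Longrightarrow> \<exists>V N. open N \<and> 0 \<in> N \<and> N \<subseteq> V \<and> V \<subseteq> W \<and>
         (\<forall>x\<in>V. \<forall>y\<in>V. \<forall>u\<ge>0. \<forall>v\<ge>0. u + v = 1 \<longrightarrow> u *\<^sub>R x + v *\<^sub>R y \<in> V)"

definition topological_dual :: "('a::locally_convex_space \<Rightarrow> real) set" where
  "topological_dual = {f. linear f \<and> continuous_on UNIV f}"

definition balanced :: "'a::real_vector set \<Rightarrow> bool" where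
  "balanced V \<longleftrightarrow> (\<forall>c. \<bar>c\<bar> \<le> 1 \<longrightarrow> (\<lambda>x. c *\<^sub>R x) ` V \<subseteq> V)"

definition base_at_zero :: "'a::locally_convex_space set set \<Rightarrow> bool" where
  "base_at_zero \<B> \<longleftrightarrow>
     (\<forall>V\<in>\<B>. 0 \<in> interior V) \<and> (\<forall>W. open W \<and> 0 \<in> W \<longrightarrow> (\<exists>V\<in>\<B>. V \<subseteq> W))"

definition minkowski :: "'a::real_vector set \<Rightarrow> 'a \<Rightarrow> real" where
  "minkowski V x = Inf {l. 0 < l \<and> x \<in> (\<lambda>v. l *\<^sub>R v) ` V}"

text \<open>
  \<open>E\<close> (type \<open>'e\<close>) is identified with the topological dual of \<open>D\<close> (type \<open>'d\<close>) through the pairing.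
  The topology that \<open>E\<close> carries as a locally convex space is not fixed, it only has to make every
  evaluation \<open>e \<mapsto> \<langle>z, e\<rangle>\<close> continuous, i.e. to be finer than \<open>\<sigma>(E, D)\<close>; the strong, Mackey and
  weak$^*$ topologies all qualify.
\<close>

definition dual_pairing :: "('d::locally_convex_space \<Rightarrow> 'e::locally_convex_space \<Rightarrow> real) \<Rightarrow> bool" where
  "dual_pairing pair \<longleftrightarrow>
     bilinear pair \<and> bij_betw (\<lambda>e z. pair z e) UNIV topological_dual \<and>
     (\<forall>z. continuous_on UNIV (pair z))"

definition weak_star :: "('d \<Rightarrow> 'e \<Rightarrow> real) \<Rightarrow> 'e topology" where
  "weak_star pair = topology_generated_by {pair z -` W | z W. open W}"

section \<open>Means\<close>

definition bounded_functions :: "('s \<Rightarrow> real) set" where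
  "bounded_functions = {g. bounded (range g)}"

definition sup_norm :: "('s \<Rightarrow> real) \<Rightarrow> real" where
  "sup_norm g = (SUP s. \<bar>g s\<bar>)"

definition function_subspace :: "('s \<Rightarrow> real) set \<Rightarrow> bool" where
  "function_subspace X \<longleftrightarrow>
     X \<subseteq> bounded_functions \<and> (\<lambda>_. 0) \<in> X \<and>
     (\<forall>f\<in>X. \<forall>g\<in>X. (\<lambda>s. f s + g s) \<in> X) \<and> (\<forall>c. \<forall>f\<in>X. (\<lambda>s. c * f s) \<in> X)"

text \<open>
  Functionals on a subspace \<open>X\<close> are total functions, of which only the values on \<open>X\<close> matter.
\<close>

definition norm_dual :: "('s \<Rightarrow> real) set \<Rightarrow> (('s \<Rightarrow> real) \<Rightarrow> real) set" where
  "norm_dual X = {\<mu>.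
     (\<forall>f\<in>X. \<forall>g\<in>X. \<mu> (\<lambda>s. f s + g s) = \<mu> f + \<mu> g) \<and>
     (\<forall>c. \<forall>f\<in>X. \<mu> (\<lambda>s. c * f s) = c * \<mu> f) \<and>
     (\<exists>K. \<forall>f\<in>X. \<bar>\<mu> f\<bar> \<le> K * sup_norm f)}"

definition dual_norm :: "('s \<Rightarrow> real) set \<Rightarrow> (('s \<Rightarrow> real) \<Rightarrow> real) \<Rightarrow> real" where
  "dual_norm X \<mu> = (SUP f\<in>{f\<in>X. sup_norm f \<le> 1}. \<bar>\<mu> f\<bar>)"

definition mean_on :: "('s \<Rightarrow> real) set \<Rightarrow> (('s \<Rightarrow> real) \<Rightarrow> real) \<Rightarrow> bool" where
  "mean_on X \<mu> \<longleftrightarrow> \<mu> \<in> norm_dual X \<and> dual_norm X \<mu> = 1 \<and> \<mu> (\<lambda>_. 1) = 1"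

definition right_translate :: "'s::semigroup_mult \<Rightarrow> ('s \<Rightarrow> real) \<Rightarrow> 's \<Rightarrow> real" where
  "right_translate t g = (\<lambda>s. g (s * t))"

definition right_invariant :: "('s::semigroup_mult \<Rightarrow> real) set \<Rightarrow> (('s \<Rightarrow> real) \<Rightarrow> real) \<Rightarrow> bool" where
  "right_invariant X \<mu> \<longleftrightarrow> (\<forall>s. \<forall>g\<in>X. \<mu> (right_translate s g) = \<mu> g)"

definition is_mean_integral ::
    "(('s \<Rightarrow> real) \<Rightarrow> real) \<Rightarrow> ('s \<Rightarrow> 'e::locally_convex_space) \<Rightarrow> 'e \<Rightarrow> bool" where
  "is_mean_integral \<mu> h y \<longleftrightarrow> (\<forall>f\<in>topological_dual. f y = \<mu> (\<lambda>t. f (h t)))"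

text \<open>The map \<open>T\<^sub>\<mu>\<close>; meaningful at \<open>x\<close> only if there is exactly one such \<open>y\<close>.\<close>

definition mean_map ::
    "(('s \<Rightarrow> real) \<Rightarrow> real) \<Rightarrow> ('s \<Rightarrow> 'e \<Rightarrow> 'e::locally_convex_space) \<Rightarrow> 'e \<Rightarrow> 'e" where
  "mean_map \<mu> T x = (THE y. is_mean_integral \<mu> (\<lambda>t. T t x) y)"

section \<open>Representations, nonexpansiveness and attractive points\<close>

definition representation :: "'e set \<Rightarrow> ('s::semigroup_mult \<Rightarrow> 'e \<Rightarrow> 'e) \<Rightarrow> bool" where
  "representation C T \<longleftrightarrow>
     (\<forall>s. T s \<in> C \<rightarrow> C) \<and> (\<forall>s t. \<forall>x\<in>C. T (s * t) x = T s (T t x))"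

definition common_fixed_points :: "'e set \<Rightarrow> ('s \<Rightarrow> 'e \<Rightarrow> 'e) \<Rightarrow> 'e set" where
  "common_fixed_points C T = (\<Inter>s. {x \<in> C. T s x = x})"

definition QG_nonexpansive ::
    "('e::ab_group_add \<Rightarrow> real) set \<Rightarrow> 'e pair_pre_digraph \<Rightarrow> ('e \<Rightarrow> 'e) \<Rightarrow> bool" where
  "QG_nonexpansive Q G T \<longleftrightarrow>
     (\<forall>q\<in>Q. \<forall>x\<in>pverts G. \<forall>y\<in>pverts G. (x, y) \<in> parcs G \<longrightarrow> q (T x - T y) \<le> q (x - y))"

text \<open>
  For \<open>Q\<close>-\<open>G\<close>-attractive points the edges of \<open>G\<close> do not occur, only the
  vertex set \<open>C\<close> matters.
\<close>

definition attractive_point ::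
    "('e::ab_group_add \<Rightarrow> real) set \<Rightarrow> 'e set \<Rightarrow> ('e \<Rightarrow> 'e) \<Rightarrow> 'e \<Rightarrow> bool" where
  "attractive_point Q C T a \<longleftrightarrow> (\<forall>x\<in>C. \<forall>q\<in>Q. q (a - T x) \<le> q (a - x))"

definition attractive_point_family ::
    "('e::ab_group_add \<Rightarrow> real) set \<Rightarrow> 'e set \<Rightarrow> ('s \<Rightarrow> 'e \<Rightarrow> 'e) \<Rightarrow> 'e \<Rightarrow> bool" where
  "attractive_point_family Q C T a \<longleftrightarrow> (\<forall>t. \<forall>x\<in>C. \<forall>q\<in>Q. q (a - T t x) \<le> q (a - x))"

end

(* Every continuous linear functional f satisfies f (T_mu x) = mu (f (T_t x)), and a mean is monotone,
   so a bound on f (T_t x) uniform in t passes to f (T_mu x).  Hahn-Banach turns this into (i), (iii)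
   and (v): a point outside the closure of a convex set is separated from it, and a Minkowski
   functional q is attained at a given point by some continuous linear f \<le> q.  For (iii) no separation
   in the weak-star topology is needed, since the topology of E is finer.  Hahn-Banach itself is
   obtained from Zorn's lemma: a minimal sublinear functional is linear. *)

theory Submission
  imports Defs
begin

section \<open>Sublinear functionals and the Hahn-Banach theorem\<close>

definition sublinear :: "('a::real_vector \<Rightarrow> real) \<Rightarrow> bool" where
  "sublinear p \<longleftrightarrow> (\<forall>x y. p (x + y) \<le> p x + p y) \<and> (\<forall>c x. 0 \<le> c \<longrightarrow> p (c *\<^sub>R x) = c * p x)"

text \<open>For \<open>0 < c\<close> the reverse inequality comes from \<open>le\<close> applied to
  \<open>1 / c\<close> and \<open>c *\<^sub>R x\<close>. For \<open>c = 0\<close>, subadditivity at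
  the origin gives \<open>0 \<le> p 0\<close>.\<close>

lemma sublinearI:
  assumes "\<And>x y. p (x + y) \<le> p x + p y" and "p 0 \<le> 0"
    and le: "\<And>c x. 0 < c \<Longrightarrow> p (c *\<^sub>R x) \<le> c * p x"
  shows "sublinear p"
proof -
  have "p (c *\<^sub>R x) = c * p x" if "0 \<le> c" for c x
  proof (cases "c = 0")
    case True
    have "p 0 \<le> p 0 + p 0" using assms(1)[of 0 0] by simp
    with assms(2) True show ?thesis by simp
  next
    case False
    with that have c: "0 < c" by simp
    have "p x \<le> (1 / c) * p (c *\<^sub>R x)" using le[of "1 / c" "c *\<^sub>R x"] c by simp
    with le[OF c, of x] c show ?thesis by (simp add: field_simps)
  qed
  with assms(1) show ?thesis by (simp add: sublinear_def)
qed

lemma sublinear_add: "sublinear p \<Longrightarrow> p (x + y) \<le> p x + p y"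
  by (simp add: sublinear_def)

lemma sublinear_scaleR: "sublinear p \<Longrightarrow> 0 \<le> c \<Longrightarrow> p (c *\<^sub>R x) = c * p x"
  by (simp add: sublinear_def)

lemma sublinear_0: "sublinear p \<Longrightarrow> p 0 = 0"
  using sublinear_scaleR[of p 0] by simp

lemma sublinear_uminus_ge: "sublinear p \<Longrightarrow> - p (- x) \<le> p x"
  using sublinear_add[of p x "- x"] sublinear_0[of p] by simp

text \<open>
  The largest sublinear minorant of \<open>p\<close> that is at most \<open>- h\<close> on \<open>- K\<close>, so that each linear
  functional below it is at least \<open>h\<close> on \<open>K\<close>.
\<close>

definition sublinear_shift :: "('a::real_vector \<Rightarrow> real) \<Rightarrow> 'a set \<Rightarrow> real \<Rightarrow> 'a \<Rightarrow> real" where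
  "sublinear_shift p K h x = (INF (s, k)\<in>{0..} \<times> K. p (x + s *\<^sub>R k) - s * h)"

context
  fixes p :: "'a::real_vector \<Rightarrow> real" and K :: "'a set" and h :: real
  assumes p: "sublinear p" and K: "convex K" "K \<noteq> {}" and h: "\<And>k. k \<in> K \<Longrightarrow> h \<le> p k"
begin

text \<open>The bound is independent of \<open>s\<close> and \<open>k\<close>, so the infimum
  defining \<open>sublinear_shift\<close> is over a set bounded below.\<close>

lemma sublinear_shift_lower:
  assumes "0 \<le> s" "k \<in> K"
  shows "- p (- x) \<le> p (x + s *\<^sub>R k) - s * h"
proof -
  have "s * h \<le> p (s *\<^sub>R k)" using assms h p by (simp add: sublinear_scaleR mult_left_mono)
  also have "\<dots> \<le> p (x + s *\<^sub>R k) + p (- x)" using sublinear_add[OF p, of "x + s *\<^sub>R k" "- x"] by simp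
  finally show ?thesis by simp
qed

lemma sublinear_shift_le:
  assumes "0 \<le> s" "k \<in> K"
  shows "sublinear_shift p K h x \<le> p (x + s *\<^sub>R k) - s * h"
proof -
  have "bdd_below ((\<lambda>(s, k). p (x + s *\<^sub>R k) - s * h) ` ({0..} \<times> K))"
    using sublinear_shift_lower by (intro bdd_belowI[of _ "- p (- x)"]) auto
  from cINF_lower[OF this, of "(s, k)"] assms show ?thesis by (simp add: sublinear_shift_def)
qed

lemma sublinear_shift_greatest:
  assumes "\<And>s k. 0 \<le> s \<Longrightarrow> k \<in> K \<Longrightarrow> c \<le> p (x + s *\<^sub>R k) - s * h"
  shows "c \<le> sublinear_shift p K h x"
  unfolding sublinear_shift_def using assms K(2) by (intro cINF_greatest) auto

lemma sublinear_shift_le_self: "sublinear_shift p K h x \<le> p x"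
  using sublinear_shift_le[of 0 _ x] K(2) by auto

text \<open>Homogeneity holds because the pairs \<open>(s, k)\<close> at \<open>x\<close> correspond
  to \<open>(c * s, k)\<close> at \<open>c *\<^sub>R x\<close>. Subadditivity holds because two
  shifts along the convex set \<open>K\<close> combine into one.\<close>

lemma sublinear_sublinear_shift: "sublinear (sublinear_shift p K h)"
proof (rule sublinearI)
  let ?P = "sublinear_shift p K h"
  show "?P 0 \<le> 0" using sublinear_shift_le_self[of 0] sublinear_0[OF p] by simp
  show "?P (c *\<^sub>R x) \<le> c * ?P x" if c: "0 < c" for c x
  proof -
    have "?P (c *\<^sub>R x) / c \<le> ?P x"
    proof (rule sublinear_shift_greatest)
      fix s k assume sk: "0 \<le> (s::real)" "k \<in> K"
      have "?P (c *\<^sub>R x) \<le> p (c *\<^sub>R (x + s *\<^sub>R k)) - (c * s) * h"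
        using sublinear_shift_le[of "c * s" k "c *\<^sub>R x"] sk c by (simp add: scaleR_add_right)
      also have "\<dots> = c * (p (x + s *\<^sub>R k) - s * h)"
        using c sublinear_scaleR[OF p, of c "x + s *\<^sub>R k"] by (simp add: right_diff_distrib)
      finally show "?P (c *\<^sub>R x) / c \<le> p (x + s *\<^sub>R k) - s * h" using c by (simp add: field_simps)
    qed
    with c show ?thesis by (simp add: field_simps)
  qed
  show "?P (x + y) \<le> ?P x + ?P y" for x y
  proof -
    have "?P (x + y) \<le> p (x + s *\<^sub>R k) - s * h + (p (y + s' *\<^sub>R k') - s' * h)"
      if sk: "0 \<le> s" "k \<in> K" "0 \<le> s'" "k' \<in> K" for s k s' k'
    proof -
      \<comment> \<open>By convexity the combined shift is \<open>s + s'\<close> times a weighted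
        average \<open>m\<close> of \<open>k\<close> and \<open>k'\<close>. If
        \<open>s + s' = 0\<close>, both shifts vanish and any point of \<open>K\<close>
        serves.\<close>
      obtain m where m: "m \<in> K" "(s + s') *\<^sub>R m = s *\<^sub>R k + s' *\<^sub>R k'"
      proof (cases "s + s' = 0")
        case True
        with sk have "s = 0" "s' = 0" by auto
        with that[of k] sk show ?thesis by simp
      next
        case False
        let ?m = "(s / (s + s')) *\<^sub>R k + (s' / (s + s')) *\<^sub>R k'"
        have "?m \<in> K"
          using sk False by (intro convexD[OF K(1)]) (auto simp: add_divide_distrib[symmetric])
        moreover have "(s + s') *\<^sub>R ?m = s *\<^sub>R k + s' *\<^sub>R k'"
          using False by (simp add: scaleR_add_right)
        ultimately show ?thesis by (rule that)
      qed
      have "?P (x + y) \<le> p (x + y + (s + s') *\<^sub>R m) - (s + s') * h"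
        using sk m by (intro sublinear_shift_le) auto
      also have "x + y + (s + s') *\<^sub>R m = (x + s *\<^sub>R k) + (y + s' *\<^sub>R k')" using m by simp
      also have "p \<dots> \<le> p (x + s *\<^sub>R k) + p (y + s' *\<^sub>R k')" by (rule sublinear_add[OF p])
      finally show ?thesis by (simp add: algebra_simps)
    qed
    \<comment> \<open>The two infima are taken one after the other: first over
      \<open>(s', k')\<close>, then over \<open>(s, k)\<close>.\<close>
    then have "?P (x + y) - (p (x + s *\<^sub>R k) - s * h) \<le> ?P y" if "0 \<le> s" "k \<in> K" for s k
      using that by (intro sublinear_shift_greatest) (simp only: diff_le_eq add.commute)
    then have "?P (x + y) - ?P y \<le> ?P x"
      by (intro sublinear_shift_greatest) (simp only: diff_le_eq add.commute)
    then show ?thesis by simp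
  qed
qed

end

text \<open>The pointwise infimum works. It is bounded below since
  \<open>g x \<ge> - g (- x) \<ge> - p (- x)\<close>, and it is subadditive since of two members of
  the chain the smaller one can replace both.\<close>

lemma sublinear_chain_lower_bound:
  fixes F :: "('a::real_vector \<Rightarrow> real) set"
  assumes F: "F \<noteq> {}" "\<And>g. g \<in> F \<Longrightarrow> sublinear g \<and> g \<le> p"
    and chain: "\<And>g g'. g \<in> F \<Longrightarrow> g' \<in> F \<Longrightarrow> g \<le> g' \<or> g' \<le> g"
  obtains u where "sublinear u" "\<And>g. g \<in> F \<Longrightarrow> u \<le> g"
proof
  let ?u = "\<lambda>x. INF g\<in>F. g x"
  have "- p (- x) \<le> g x" if "g \<in> F" for g x
    using F(2)[OF that] sublinear_uminus_ge[of g x] by (auto simp: le_fun_def intro: order_trans[rotated])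
  then have bdd: "bdd_below ((\<lambda>g. g x) ` F)" for x by (intro bdd_belowI[of _ "- p (- x)"]) auto
  have le: "?u x \<le> g x" if "g \<in> F" for g x using cINF_lower[OF bdd that] .
  then show "?u \<le> g" if "g \<in> F" for g using that by (simp add: le_fun_def)
  show "sublinear ?u"
  proof (rule sublinearI)
    from F obtain g where "g \<in> F" by auto
    with le[of g 0] F(2)[of g] sublinear_0[of g] show "?u 0 \<le> 0" by simp
    show "?u (c *\<^sub>R x) \<le> c * ?u x" if c: "0 < c" for c x
    proof -
      have "?u (c *\<^sub>R x) / c \<le> ?u x"
      proof (rule cINF_greatest[OF F(1)])
        fix g assume g: "g \<in> F"
        have "?u (c *\<^sub>R x) \<le> c * g x"
          using le[OF g, of "c *\<^sub>R x"] sublinear_scaleR[of g c x] F(2)[OF g] c by simp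
        with c show "?u (c *\<^sub>R x) / c \<le> g x" by (simp add: field_simps)
      qed
      with c show ?thesis by (simp add: field_simps)
    qed
    show "?u (x + y) \<le> ?u x + ?u y" for x y
    proof -
      have *: "?u (x + y) \<le> g x + g' y" if g: "g \<in> F" "g' \<in> F" for g g'
      proof -
        from chain[OF g] obtain k where k: "k \<in> F" "k \<le> g" "k \<le> g'" using g by auto
        have "?u (x + y) \<le> k x + k y"
          using le[OF k(1)] sublinear_add[of k x y] F(2)[OF k(1)] by (auto intro: order_trans)
        also have "\<dots> \<le> g x + g' y" using k by (simp add: le_fun_def add_mono)
        finally show ?thesis .
      qed
      have "?u (x + y) - g x \<le> ?u y" if "g \<in> F" for g
        using *[OF that] by (intro cINF_greatest[OF F(1)]) (simp add: algebra_simps)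
      then have "?u (x + y) - ?u y \<le> ?u x"
        by (intro cINF_greatest[OF F(1)]) (simp add: algebra_simps)
      then show ?thesis by simp
    qed
  qed
qed

theorem sublinear_dominates_linear:
  fixes p :: "'a::real_vector \<Rightarrow> real"
  assumes p: "sublinear p"
  obtains f where "linear f" "f \<le> p"
proof -
  \<comment> \<open>The order is reversed, so that the maximal element given by Zorn's lemma is a
    minimal sublinear minorant.\<close>
  let ?A = "{g. sublinear g \<and> g \<le> p}" and ?P = "\<lambda>g g' :: 'a \<Rightarrow> real. g' \<le> g"
  have "\<exists>m\<in>?A. \<forall>g\<in>?A. ?P m g \<longrightarrow> g = m"
  proof (rule predicate_Zorn)
    show "partial_order_on ?A (relation_of ?P ?A)"
      by (rule partial_order_on_relation_ofI) auto
    fix F assume F: "F \<in> Chains (relation_of ?P ?A)"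
    then have sub: "F \<subseteq> ?A" and chain: "\<And>g g'. g \<in> F \<Longrightarrow> g' \<in> F \<Longrightarrow> g \<le> g' \<or> g' \<le> g"
      by (auto simp: Chains_def relation_of_def)
    show "\<exists>u\<in>?A. \<forall>a\<in>F. ?P a u"
    proof (cases "F = {}")
      case True
      with p show ?thesis by auto
    next
      case False
      obtain u where u: "sublinear u" "\<And>g. g \<in> F \<Longrightarrow> u \<le> g"
        using sublinear_chain_lower_bound[OF False, of p] sub chain by blast
      moreover have "u \<le> p" using False u(2) sub by (metis (mono_tags) all_not_in_conv mem_Collect_eq order_trans subsetD)
      ultimately show ?thesis by auto
    qed
  qed
  then obtain m where m: "sublinear m" "m \<le> p"
    and min: "\<And>g. sublinear g \<Longrightarrow> g \<le> m \<Longrightarrow> g = m" by (auto intro: order_trans)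
  have add: "m (x + y) = m x + m y" for x y
  proof (rule antisym)
    show "m (x + y) \<le> m x + m y" by (rule sublinear_add[OF m(1)])
    \<comment> \<open>Shifting along \<open>y\<close> alone gives a sublinear minorant of
      \<open>m\<close>, which equals \<open>m\<close> by minimality. Bounding its value at
      \<open>x\<close> by the term with \<open>s = 1\<close> gives superadditivity.\<close>
    let ?g = "sublinear_shift m {y} (m y)"
    have "?g = m"
    proof (rule min)
      show "sublinear ?g" using m(1) by (rule sublinear_sublinear_shift) auto
      show "?g \<le> m"
        unfolding le_fun_def using m(1) by (intro allI sublinear_shift_le_self) auto
    qed
    moreover have "?g x \<le> m (x + 1 *\<^sub>R y) - 1 * m y"
      using m(1) by (rule sublinear_shift_le) auto
    ultimately show "m x + m y \<le> m (x + y)" by simp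
  qed
  have neg: "m (- x) = - m x" for x using add[of x "- x"] sublinear_0[OF m(1)] by simp
  have "linear m"
  proof (rule linearI)
    show "m (c *\<^sub>R x) = c *\<^sub>R m x" for c x
    proof (cases "0 \<le> c")
      case True
      then show ?thesis by (simp add: sublinear_scaleR[OF m(1)])
    next
      case False
      then have "m ((- c) *\<^sub>R x) = - c * m x" by (intro sublinear_scaleR[OF m(1)]) auto
      then show ?thesis by (simp add: neg)
    qed
  qed (rule add)
  with m(2) show ?thesis by (rule that[rotated -1])
qed

text \<open>Mazur and Orlicz' form of the Hahn-Banach theorem.\<close>

theorem sublinear_dominates_linear_convex:
  fixes p :: "'a::real_vector \<Rightarrow> real"
  assumes p: "sublinear p" and K: "convex K" "K \<noteq> {}" and h: "\<And>k. k \<in> K \<Longrightarrow> h \<le> p k"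
  obtains f where "linear f" "\<And>x. f x \<le> p x" "\<And>k. k \<in> K \<Longrightarrow> h \<le> f k"
proof -
  note ctxt = p K h
  obtain f where f: "linear f" "f \<le> sublinear_shift p K h"
    using sublinear_dominates_linear[OF sublinear_sublinear_shift[OF ctxt]] by blast
  then have le: "f x \<le> sublinear_shift p K h x" for x by (simp add: le_fun_def)
  show ?thesis
  proof
    show "linear f" by fact
    show "f x \<le> p x" for x using le[of x] sublinear_shift_le_self[OF ctxt, of x] by simp
    show "h \<le> f k" if k: "k \<in> K" for k
    proof -
      \<comment> \<open>At \<open>- k\<close> the term with \<open>s = 1\<close> is
        \<open>p 0 - h = - h\<close>.\<close>
      have "f (- k) \<le> p (- k + 1 *\<^sub>R k) - 1 * h"
        using le[of "- k"] sublinear_shift_le[OF ctxt _ k, of 1 "- k"] by simp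
      then show ?thesis using linear_neg[OF f(1)] sublinear_0[OF p] by simp
    qed
  qed
qed

section \<open>Convex neighbourhoods, Minkowski functionals and separation\<close>

lemma tendsto_scaleR_lcs:
  fixes g :: "'b \<Rightarrow> 'a::locally_convex_space"
  assumes "(f \<longlongrightarrow> c) F" "(g \<longlongrightarrow> x) F"
  shows "((\<lambda>t. f t *\<^sub>R g t) \<longlongrightarrow> c *\<^sub>R x) F"
  using filterlim_compose[OF tendsto_scaleR_Pair filterlim_Pair[OF assms]] by simp

lemma convex_neighbourhood:
  fixes W :: "'a::locally_convex_space set"
  assumes "open W" "0 \<in> W"
  obtains V where "convex V" "0 \<in> interior V" "V \<subseteq> W"
proof -
  from convex_neighbourhoods[OF assms] obtain V N where "open N" "0 \<in> N" "N \<subseteq> V" "V \<subseteq> W"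
    and "\<forall>x\<in>V. \<forall>y\<in>V. \<forall>u\<ge>0. \<forall>v\<ge>0. u + v = 1 \<longrightarrow> u *\<^sub>R x + v *\<^sub>R y \<in> V" by blast
  then show ?thesis by (intro that[of V]) (auto simp: convex_def intro: interiorI)
qed

context
  fixes V :: "'a::locally_convex_space set"
  assumes V: "convex V" "0 \<in> interior V"
begin

lemma zero_in_neighbourhood: "0 \<in> V"
  using V(2) interior_subset by blast

text \<open>Neighbourhoods of \<open>0\<close> are absorbing: \<open>x\<close> divided by
  \<open>n + 1\<close> tends to \<open>0\<close> by continuity of scalar multiplication, so it
  eventually lies in \<open>V\<close>.\<close>

lemma minkowski_set_nonempty: "{l. 0 < l \<and> x \<in> (\<lambda>v. l *\<^sub>R v) ` V} \<noteq> {}"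
proof -
  have "((\<lambda>n. inverse (real (Suc n)) *\<^sub>R x) \<longlongrightarrow> 0 *\<^sub>R x) sequentially"
    by (intro tendsto_scaleR_lcs LIMSEQ_inverse_real_of_nat tendsto_const)
  then have "\<forall>\<^sub>F n in sequentially. inverse (real (Suc n)) *\<^sub>R x \<in> interior V"
    using V(2) by (auto dest: topological_tendstoD)
  then obtain n where "inverse (real (Suc n)) *\<^sub>R x \<in> V"
    using eventually_happens'[OF sequentially_bot] interior_subset by blast
  then have "x \<in> (\<lambda>v. real (Suc n) *\<^sub>R v) ` V" by (intro image_eqI) auto
  then have "real (Suc n) \<in> {l. 0 < l \<and> x \<in> (\<lambda>v. l *\<^sub>R v) ` V}" by simp
  then show ?thesis by blast
qed

lemma minkowski_le: "0 < l \<Longrightarrow> v \<in> V \<Longrightarrow> minkowski V (l *\<^sub>R v) \<le> l"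
  unfolding minkowski_def by (rule cInf_lower) (auto intro!: bdd_belowI[of _ 0])

lemma minkowski_approx:
  assumes "minkowski V x < c"
  obtains l v where "0 < l" "l < c" "v \<in> V" "x = l *\<^sub>R v"
  using cInf_lessD[OF minkowski_set_nonempty assms[unfolded minkowski_def]] by auto

lemma minkowski_less_1: "minkowski V x < 1 \<Longrightarrow> x \<in> V"
proof -
  assume "minkowski V x < 1"
  then obtain l v where lv: "0 < l" "l < 1" "v \<in> V" "x = l *\<^sub>R v" by (rule minkowski_approx)
  then have "l *\<^sub>R v + (1 - l) *\<^sub>R 0 \<in> V" by (intro convexD[OF V(1)] zero_in_neighbourhood) auto
  with lv show ?thesis by simp
qed

lemma sublinear_minkowski: "sublinear (minkowski V)"
proof (rule sublinearI)
  show "minkowski V 0 \<le> 0"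
  proof (rule field_le_epsilon)
    fix e :: real assume "0 < e"
    then show "minkowski V 0 \<le> 0 + e" using minkowski_le[OF _ zero_in_neighbourhood, of e] by simp
  qed
  show "minkowski V (c *\<^sub>R x) \<le> c * minkowski V x" if c: "0 < c" for c x
  proof (rule dense_ge)
    fix r assume r: "c * minkowski V x < r"
    with c have "minkowski V x < r / c" by (simp add: field_simps)
    then obtain l v where lv: "0 < l" "l < r / c" "v \<in> V" "x = l *\<^sub>R v" by (rule minkowski_approx)
    then have "minkowski V (c *\<^sub>R x) \<le> c * l" using minkowski_le[of "c * l" v] c by simp
    also have "\<dots> \<le> r" using lv c by (simp add: field_simps)
    finally show "minkowski V (c *\<^sub>R x) \<le> r" .
  qed
  show "minkowski V (x + y) \<le> minkowski V x + minkowski V y" for x y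
  proof (rule field_le_epsilon)
    fix e :: real assume e: "0 < e"
    obtain l v where lv: "0 < l" "l < minkowski V x + e / 2" "v \<in> V" "x = l *\<^sub>R v"
      using minkowski_approx[of x "minkowski V x + e / 2"] e by auto
    obtain m w where mw: "0 < m" "m < minkowski V y + e / 2" "w \<in> V" "y = m *\<^sub>R w"
      using minkowski_approx[of y "minkowski V y + e / 2"] e by auto
    \<comment> \<open>The weights make \<open>(l + m) *\<^sub>R ?u\<close> equal to
      \<open>x + y\<close>, while convexity keeps \<open>?u\<close> in \<open>V\<close>.\<close>
    let ?u = "(l / (l + m)) *\<^sub>R v + (m / (l + m)) *\<^sub>R w"
    have "?u \<in> V"
      using lv mw by (intro convexD[OF V(1)]) (auto simp: add_divide_distrib[symmetric])
    then have "minkowski V ((l + m) *\<^sub>R ?u) \<le> l + m" using lv mw by (intro minkowski_le) auto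
    also have "(l + m) *\<^sub>R ?u = x + y" using lv mw by (simp add: scaleR_add_right)
    finally show "minkowski V (x + y) \<le> minkowski V x + minkowski V y + e" using lv mw by simp
  qed
qed

text \<open>The bound gives \<open>f \<le> 1\<close> on \<open>V\<close>. Scaling turns this into
  continuity at \<open>0\<close>, and linearity carries it to every point.\<close>

lemma linear_le_minkowski_continuous:
  assumes f: "linear f" and le: "\<And>x. f x \<le> minkowski V x"
  shows "f \<in> topological_dual"
proof -
  have f1: "f v \<le> 1" if "v \<in> V" for v using le[of v] minkowski_le[OF _ that, of 1] by simp
  \<comment> \<open>For \<open>x\<close> near \<open>0\<close> the multiple by
    \<open>2 * c / e\<close> lies in \<open>V\<close>, hence \<open>c * f x \<le> e / 2 < e\<close>.
    The cases \<open>c = 1\<close> and \<open>c = -1\<close> together bound the absolute value of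
    \<open>f x\<close>.\<close>
  have half: "\<forall>\<^sub>F x in nhds 0. c * f x < e" if e: "0 < e" for c e :: real
  proof -
    have "((\<lambda>x. (2 * c / e) *\<^sub>R x) \<longlongrightarrow> (2 * c / e) *\<^sub>R 0) (nhds (0::'a))"
      by (intro tendsto_scaleR_lcs tendsto_const filterlim_ident)
    then have "\<forall>\<^sub>F x in nhds 0. (2 * c / e) *\<^sub>R x \<in> interior V"
      using V(2) by (auto dest: topological_tendstoD)
    then show ?thesis
    proof (rule eventually_mono)
      fix x assume "(2 * c / e) *\<^sub>R x \<in> interior V"
      then have "f ((2 * c / e) *\<^sub>R x) \<le> 1" using interior_subset f1 by blast
      then have "2 * (c * f x) \<le> e" using e by (simp add: linear_cmul[OF f] field_simps)
      with e show "c * f x < e" by linarith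
    qed
  qed
  have "(f \<longlongrightarrow> 0) (nhds 0)"
  proof (rule tendstoI)
    fix e :: real assume "0 < e"
    from half[OF this, of 1] half[OF this, of "-1"]
    show "\<forall>\<^sub>F x in nhds 0. dist (f x) 0 < e" by eventually_elim (auto simp: dist_real_def)
  qed
  moreover have "((\<lambda>x. x - a) \<longlongrightarrow> 0) (at a)" for a :: 'a
    using tendsto_diff[OF tendsto_ident_at[of a UNIV] tendsto_const[of a]] by simp
  ultimately have "((\<lambda>x. f (x - a)) \<longlongrightarrow> 0) (at a)" for a
    by (rule filterlim_compose)
  then have "(f \<longlongrightarrow> f a) (at a)" for a
    using tendsto_add[of "\<lambda>x. f (x - a)" 0 "at a" "\<lambda>x. f a" "f a"] by (simp add: linear_diff[OF f])
  then show ?thesis using f by (simp add: topological_dual_def continuous_on_def)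
qed

text \<open>The Mazur-Orlicz form is applied to the singleton \<open>{z}\<close> with the value at
  \<open>z\<close> as lower bound; domination then forces equality there.\<close>

lemma minkowski_attained:
  obtains f where "f \<in> topological_dual" "\<And>x. f x \<le> minkowski V x" "f z = minkowski V z"
proof -
  obtain f where f: "linear f" "\<And>x. f x \<le> minkowski V x" "\<And>k. k \<in> {z} \<Longrightarrow> minkowski V z \<le> f k"
    by (rule sublinear_dominates_linear_convex[OF sublinear_minkowski, of "{z}" "minkowski V z"]) auto
  with linear_le_minkowski_continuous show ?thesis by (intro that[of f]) (auto intro: antisym)
qed

end

text \<open>Choose a convex neighbourhood \<open>V\<close> of \<open>0\<close> such that
  \<open>y - v\<close> avoids the closure of \<open>K\<close> for every \<open>v\<close> in
  \<open>V\<close>. No \<open>y - k\<close> with \<open>k\<close> in \<open>K\<close> then lies in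
  \<open>V\<close>, so the Minkowski functional is at least 1 on the convex set of these
  differences, and a linear functional below it inherits that bound.\<close>

theorem separate_point_closure_convex:
  fixes K :: "'a::locally_convex_space set"
  assumes K: "convex K" and y: "y \<notin> closure K"
  obtains f where "f \<in> topological_dual" "\<And>k. k \<in> K \<Longrightarrow> f k \<le> f y - 1"
proof (cases "K = {}")
  case True
  have "(\<lambda>_. 0) \<in> topological_dual" by (simp add: topological_dual_def linear_iff)
  with True show ?thesis by (intro that) auto
next
  case False
  have "open ((\<lambda>w. y - w) -` (- closure K))"
    by (intro open_vimage continuous_intros) auto
  then obtain V where V: "convex V" "0 \<in> interior V" "V \<subseteq> (\<lambda>w. y - w) -` (- closure K)"
    by (rule convex_neighbourhood) (use y in simp)
  let ?K = "(\<lambda>k. y - k) ` K"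
  have "1 \<le> minkowski V x" if "x \<in> ?K" for x
    using that minkowski_less_1[OF V(1,2), of x] V(3) closure_subset[of K] by (force simp: not_less[symmetric])
  moreover have "convex ?K"
  proof -
    have "?K = (\<lambda>x. y + x) ` (\<lambda>k. - 1 *\<^sub>R k) ` K" by (auto simp: image_image)
    then show ?thesis using K by (simp only: convex_translation convex_scaling)
  qed
  ultimately obtain f where f: "linear f" "\<And>x. f x \<le> minkowski V x" "\<And>x. x \<in> ?K \<Longrightarrow> 1 \<le> f x"
    using sublinear_dominates_linear_convex[OF sublinear_minkowski[OF V(1,2)], of ?K 1] False by blast
  have "f \<in> topological_dual" using linear_le_minkowski_continuous[OF V(1,2) f(1,2)] .
  moreover have "f k \<le> f y - 1" if "k \<in> K" for k
    using f(3)[of "y - k"] that linear_diff[OF f(1), of y k] by auto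
  ultimately show ?thesis by (rule that)
qed

section \<open>Means and mean integrals\<close>

locale mean =
  fixes X :: "('s \<Rightarrow> real) set" and \<mu> :: "('s \<Rightarrow> real) \<Rightarrow> real"
  assumes subspace: "function_subspace X" and one: "(\<lambda>_. 1) \<in> X" and mean: "mean_on X \<mu>"
begin

lemma X_add: "f \<in> X \<Longrightarrow> g \<in> X \<Longrightarrow> (\<lambda>s. f s + g s) \<in> X"
  using subspace by (simp add: function_subspace_def)

lemma X_cmult: "f \<in> X \<Longrightarrow> (\<lambda>s. c * f s) \<in> X"
  using subspace by (simp add: function_subspace_def)

lemma X_const: "(\<lambda>_. c) \<in> X"
  using X_cmult[OF one, of c] by simp

lemma X_diff: "f \<in> X \<Longrightarrow> g \<in> X \<Longrightarrow> (\<lambda>s. f s - g s) \<in> X"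
  using X_add[of f "\<lambda>s. - 1 * g s"] X_cmult[of g "- 1"] by simp

lemma mean_add: "f \<in> X \<Longrightarrow> g \<in> X \<Longrightarrow> \<mu> (\<lambda>s. f s + g s) = \<mu> f + \<mu> g"
  using mean by (simp add: mean_on_def norm_dual_def)

lemma mean_cmult: "f \<in> X \<Longrightarrow> \<mu> (\<lambda>s. c * f s) = c * \<mu> f"
  using mean by (simp add: mean_on_def norm_dual_def)

lemma mean_const: "\<mu> (\<lambda>_. c) = c"
  using mean_cmult[OF one, of c] mean by (simp add: mean_on_def)

lemma mean_diff: "f \<in> X \<Longrightarrow> g \<in> X \<Longrightarrow> \<mu> (\<lambda>s. f s - g s) = \<mu> f - \<mu> g"
  using mean_add[of f "\<lambda>s. - 1 * g s"] X_cmult[of g "- 1"] mean_cmult[of g "- 1"] by simp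

text \<open>Dividing \<open>g\<close> by \<open>r\<close> puts it in the unit ball of
  \<open>X\<close>, where the absolute value of \<open>\<mu>\<close> is at most the dual norm
  1.\<close>

lemma abs_mean_le:
  assumes g: "g \<in> X" and r: "0 < r" "\<And>s. \<bar>g s\<bar> \<le> r"
  shows "\<bar>\<mu> g\<bar> \<le> r"
proof -
  let ?U = "{f \<in> X. sup_norm f \<le> 1}"
  from mean obtain B where B: "\<And>f. f \<in> X \<Longrightarrow> \<bar>\<mu> f\<bar> \<le> B * sup_norm f"
    unfolding mean_on_def norm_dual_def by blast
  \<comment> \<open>The supremum \<open>dual_norm\<close> dominates its members only once they are
    known to be bounded. The sign of \<open>B\<close> is unknown, so its absolute value is the
    bound.\<close>
  have "bdd_above ((\<lambda>f. \<bar>\<mu> f\<bar>) ` ?U)"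
  proof (rule bdd_aboveI2)
    fix f assume f: "f \<in> ?U"
    then have "bounded (range f)" using subspace by (auto simp: function_subspace_def bounded_functions_def)
    then have "bdd_above (range (\<lambda>s. \<bar>f s\<bar>))" by (auto simp: bounded_iff intro: bdd_aboveI2)
    then have "0 \<le> sup_norm f" unfolding sup_norm_def by (rule cSUP_upper2) auto
    then have "B * sup_norm f \<le> \<bar>B\<bar> * 1" using f by (intro mult_mono) auto
    with B[of f] f show "\<bar>\<mu> f\<bar> \<le> \<bar>B\<bar>" by simp
  qed
  moreover have "(\<lambda>s. inverse r * g s) \<in> ?U"
  proof -
    have "\<bar>inverse r * g s\<bar> \<le> 1" for s using r(1) r(2)[of s] by (simp add: abs_mult field_simps)
    then have "sup_norm (\<lambda>s. inverse r * g s) \<le> 1" unfolding sup_norm_def by (intro cSUP_least) auto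
    with X_cmult[OF g] show ?thesis by simp
  qed
  ultimately have "\<bar>\<mu> (\<lambda>s. inverse r * g s)\<bar> \<le> dual_norm X \<mu>"
    unfolding dual_norm_def by (rule cSUP_upper[rotated])
  then have "inverse r * \<bar>\<mu> g\<bar> \<le> 1" using mean r(1) mean_cmult[OF g] by (simp add: mean_on_def abs_mult)
  with r(1) show ?thesis by (simp add: field_simps)
qed

text \<open>Monotonicity of \<open>\<mu>\<close> follows from its norm being 1: the values of
  \<open>g\<close> lie in an interval from \<open>a\<close> to \<open>c\<close>, and subtracting the
  midpoint turns this into a symmetric bound.\<close>

lemma mean_le:
  assumes g: "g \<in> X" and le: "\<And>s. g s \<le> c"
  shows "\<mu> g \<le> c"
proof -
  from g subspace have "bounded (range g)" by (auto simp: function_subspace_def bounded_functions_def)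
  then obtain B where "\<And>s. \<bar>g s\<bar> \<le> B" by (auto simp: bounded_iff)
  then have B: "- B \<le> g s" for s by (metis abs_le_D2 minus_le_iff)
  \<comment> \<open>The term \<open>c - 1\<close> ensures \<open>a < c\<close>, so that the radius
    \<open>(c - a) / 2\<close> is positive.\<close>
  define a where "a = min (- B) (c - 1)"
  have a: "a \<le> g s" "a < c" for s using B[of s] by (auto simp: a_def)
  have "\<bar>g s - (a + c) / 2\<bar> \<le> (c - a) / 2" for s
    using le[of s] a(1)[of s] by (simp add: abs_le_iff field_simps)
  then have "\<bar>\<mu> (\<lambda>s. g s - (a + c) / 2)\<bar> \<le> (c - a) / 2"
    using a(2) by (intro abs_mean_le X_diff g X_const) auto
  then have "\<bar>\<mu> g - (a + c) / 2\<bar> \<le> (c - a) / 2" by (simp add: mean_diff[OF g X_const] mean_const)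
  then show ?thesis by (simp add: abs_le_iff field_simps)
qed

lemma is_mean_integral_const: "is_mean_integral \<mu> (\<lambda>_. x) x"
  by (simp add: is_mean_integral_def mean_const)

lemma is_mean_integral_diff:
  fixes y z :: "'a::locally_convex_space"
  assumes "is_mean_integral \<mu> h y" "is_mean_integral \<mu> k z"
    and "\<And>f. f \<in> topological_dual \<Longrightarrow> (\<lambda>t. f (h t)) \<in> X"
    and "\<And>f. f \<in> topological_dual \<Longrightarrow> (\<lambda>t. f (k t)) \<in> X"
  shows "is_mean_integral \<mu> (\<lambda>t. h t - k t) (y - z)"
  unfolding is_mean_integral_def
proof
  fix f :: "'a \<Rightarrow> real" assume f: "f \<in> topological_dual"
  then have "f (u - v) = f u - f v" for u v by (simp add: topological_dual_def linear_diff)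
  with assms f show "f (y - z) = \<mu> (\<lambda>t. f (h t - k t))" by (simp add: is_mean_integral_def mean_diff)
qed

lemma is_mean_integral_le:
  assumes "is_mean_integral \<mu> h y" "f \<in> topological_dual" "(\<lambda>t. f (h t)) \<in> X" "\<And>t. f (h t) \<le> c"
  shows "f y \<le> c"
  using assms mean_le[of "\<lambda>t. f (h t)" c] by (simp add: is_mean_integral_def)

text \<open>A functional separating \<open>y\<close> from \<open>K\<close> satisfies
  \<open>f (h t) \<le> f y - 1\<close> for all \<open>t\<close>; applying the mean gives the
  contradiction \<open>f y \<le> f y - 1\<close>.\<close>

lemma is_mean_integral_in_closure:
  assumes "is_mean_integral \<mu> h y" "\<And>f. f \<in> topological_dual \<Longrightarrow> (\<lambda>t. f (h t)) \<in> X"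
    and "convex K" "\<And>t. h t \<in> K"
  shows "y \<in> closure K"
proof (rule ccontr)
  assume "y \<notin> closure K"
  with \<open>convex K\<close> obtain f where "f \<in> topological_dual" "\<And>k. k \<in> K \<Longrightarrow> f k \<le> f y - 1"
    using separate_point_closure_convex by blast
  with is_mean_integral_le[of h y f "f y - 1"] assms show False by auto
qed

text \<open>A continuous linear \<open>f\<close> below the Minkowski functional that attains it at
  \<open>y - z\<close> reduces the claim to monotonicity of the mean applied to
  \<open>f (h t - k t) \<le> c\<close>.\<close>

lemma minkowski_is_mean_integral_diff_le:
  assumes y: "is_mean_integral \<mu> h y" "\<And>f. f \<in> topological_dual \<Longrightarrow> (\<lambda>t. f (h t)) \<in> X"
    and z: "is_mean_integral \<mu> k z" "\<And>f. f \<in> topological_dual \<Longrightarrow> (\<lambda>t. f (k t)) \<in> X"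
    and V: "convex V" "0 \<in> interior V" and le: "\<And>t. minkowski V (h t - k t) \<le> c"
  shows "minkowski V (y - z) \<le> c"
proof -
  obtain f where f: "f \<in> topological_dual" "\<And>x. f x \<le> minkowski V x" "f (y - z) = minkowski V (y - z)"
    using minkowski_attained[OF V] by blast
  have "f (u - v) = f u - f v" for u v using f(1) by (simp add: topological_dual_def linear_diff)
  then have "(\<lambda>t. f (h t - k t)) \<in> X" using y(2)[OF f(1)] z(2)[OF f(1)] by (simp add: X_diff)
  moreover have "f (h t - k t) \<le> c" for t using f(2) le by (rule order_trans)
  ultimately have "f (y - z) \<le> c"
    using is_mean_integral_diff[OF y(1) z(1) y(2) z(2)] f(1) by (intro is_mean_integral_le)
  with f(3) show ?thesis by simp
qed

end

section \<open>Comparison with the weak-star topology\<close>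

lemma openin_weak_star_imp_open:
  assumes "dual_pairing pair" "openin (weak_star pair) W"
  shows "open W"
proof -
  have "generate_topology_on {pair z -` W | z W. open W} W"
    using assms(2) by (simp add: weak_star_def openin_topology_generated_by_iff)
  then show ?thesis
  proof induction
    case (Basis s)
    \<comment> \<open>Continuity of the evaluations, which is part of \<open>dual_pairing\<close>,
      makes each subbasic set open.\<close>
    then show ?case using assms(1) by (auto simp: dual_pairing_def intro: open_vimage)
  qed auto
qed

lemma topspace_weak_star: "topspace (weak_star pair) = UNIV"
proof -
  have "UNIV \<in> {pair z -` W | z W. open W}" by (metis (mono_tags, lifting) mem_Collect_eq open_UNIV vimage_UNIV)
  then show ?thesis unfolding weak_star_def topology_generated_by_topspace by blast
qed

lemma closure_subset_weak_star_closure: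
  assumes "dual_pairing pair"
  shows "closure K \<subseteq> weak_star pair closure_of K"
proof
  fix y assume y: "y \<in> closure K"
  have "\<exists>k\<in>K. k \<in> W" if "y \<in> W" "openin (weak_star pair) W" for W
    using y openin_weak_star_imp_open[OF assms that(2)] that(1) open_Int_closure_eq_empty[of W K] by blast
  then show "y \<in> weak_star pair closure_of K" by (auto simp: in_closure_of topspace_weak_star)
qed

section \<open>Properties of the averaged map\<close>

theorem theorem3p3:
  fixes C :: "'e::locally_convex_space set"
    and G :: "'e pair_pre_digraph"
    and \<B> :: "'e set set"
    and Q :: "('e \<Rightarrow> real) set"
    and T :: "'s::semigroup_mult \<Rightarrow> 'e \<Rightarrow> 'e"
    and X :: "('s \<Rightarrow> real) set"
    and \<mu> :: "('s \<Rightarrow> real) \<Rightarrow> real"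
  assumes "closed C" and "convex C"
    and "pair_wf_digraph G" and "pverts G = C"
    and "base_at_zero \<B>" and "\<forall>V\<in>\<B>. convex V \<and> balanced V"
    and "Q = minkowski ` \<B>"
    and "representation C T" and "\<forall>s. QG_nonexpansive Q G (T s)"
    and "function_subspace X" and "(\<lambda>_. 1) \<in> X"
    and "mean_on X \<mu>"
    and "\<forall>x\<in>C. \<forall>f\<in>topological_dual. (\<lambda>t. f (T t x)) \<in> X"
    and "\<forall>x\<in>C. \<exists>!y. is_mean_integral \<mu> (\<lambda>t. T t x) y"
  shows
    "(mean_map \<mu> T \<in> C \<rightarrow> C \<and> QG_nonexpansive Q G (mean_map \<mu> T)) \<and>
     (\<forall>x\<in>common_fixed_points C T. mean_map \<mu> T x = x) \<and>
     (\<forall>(pair :: 'd::locally_convex_space \<Rightarrow> 'e \<Rightarrow> real) (U :: 'd set) p\<^sub>U.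
        dual_pairing pair \<and> closedin (weak_star pair) C \<and>
        convex U \<and> 0 \<in> interior U \<and> p\<^sub>U = minkowski U \<and>
        (\<forall>x\<in>C. \<forall>z. (\<lambda>t. pair z (T t x)) \<in> X) \<longrightarrow>
        (\<forall>x\<in>C. mean_map \<mu> T x \<in> weak_star pair closure_of (convex hull (range (\<lambda>t. T t x))))) \<and>
     ((\<forall>s. right_translate s ` X \<subseteq> X) \<and> right_invariant X \<mu> \<longrightarrow>
        (\<forall>t. \<forall>x\<in>C. mean_map \<mu> T (T t x) = mean_map \<mu> T x)) \<and>
     (\<forall>a. attractive_point_family Q C T a \<and>
        (\<forall>x\<in>C. \<forall>f\<in>topological_dual. (\<lambda>t. f (a - T t x)) \<in> X) \<longrightarrow>
        attractive_point Q C (mean_map \<mu> T) a)"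
proof -
  interpret mean X \<mu> using assms(10-12) by (rule mean.intro)
  have intg: "is_mean_integral \<mu> (\<lambda>t. T t x) (mean_map \<mu> T x)" if "x \<in> C" for x
    unfolding mean_map_def by (rule theI'[OF bspec[OF assms(14) that]])
  \<comment> \<open>Uniqueness of the integral reduces (ii) and (iv) to checking that a proposed
    value is an integral.\<close>
  have mean_map_eq: "mean_map \<mu> T x = y" if "x \<in> C" "is_mean_integral \<mu> (\<lambda>t. T t x) y" for x y
    using assms(14) intg that by blast
  have X: "(\<lambda>t. f (T t x)) \<in> X" if "x \<in> C" "f \<in> topological_dual" for x f
    using assms(13) that by blast
  have TC: "T t x \<in> C" if "x \<in> C" for t x
    using assms(8) that by (auto simp: representation_def)
  have V: "convex V" "0 \<in> interior V" if "V \<in> \<B>" for V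
    using assms(5,6) that by (auto simp: base_at_zero_def)
  have "mean_map \<mu> T x \<in> C" if "x \<in> C" for x
    using is_mean_integral_in_closure[OF intg[OF that] X[OF that] \<open>convex C\<close> TC[OF that]]
      \<open>closed C\<close> by simp
  moreover have "QG_nonexpansive Q G (mean_map \<mu> T)"
    unfolding QG_nonexpansive_def
  proof (intro ballI impI)
    fix q x y assume q: "q \<in> Q" and xy: "x \<in> pverts G" "y \<in> pverts G" "(x, y) \<in> parcs G"
    then have C: "x \<in> C" "y \<in> C" using assms(4) by auto
    obtain W where W: "W \<in> \<B>" "q = minkowski W" using q assms(7) by auto
    \<comment> \<open>The bound along the edge is uniform in \<open>t\<close>, so it passes to the
      difference of the integrals.\<close>
    have "q (T t x - T t y) \<le> q (x - y)" for t
      using assms(9) q xy by (simp add: QG_nonexpansive_def)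
    with W show "q (mean_map \<mu> T x - mean_map \<mu> T y) \<le> q (x - y)"
      using minkowski_is_mean_integral_diff_le[OF intg[OF C(1)] X[OF C(1)] intg[OF C(2)] X[OF C(2)] V[OF W(1)]]
      by blast
  qed
  moreover have "mean_map \<mu> T x = x" if "x \<in> common_fixed_points C T" for x
  proof (rule mean_map_eq)
    show "x \<in> C" "is_mean_integral \<mu> (\<lambda>t. T t x) x"
      using that is_mean_integral_const[of x] by (auto simp: common_fixed_points_def)
  qed
  moreover have "mean_map \<mu> T x \<in> weak_star pair closure_of (convex hull (range (\<lambda>t. T t x)))"
    if "dual_pairing pair" "x \<in> C" for pair :: "'d \<Rightarrow> 'e \<Rightarrow> real" and x
  proof -
    have "mean_map \<mu> T x \<in> closure (convex hull (range (\<lambda>t. T t x)))"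
      using is_mean_integral_in_closure[OF intg[OF that(2)] X[OF that(2)] convex_convex_hull]
      by (meson hull_inc rangeI)
    with closure_subset_weak_star_closure[OF that(1)] show ?thesis by blast
  qed
  moreover have "mean_map \<mu> T (T t x) = mean_map \<mu> T x" if "right_invariant X \<mu>" "x \<in> C" for t x
  proof (rule mean_map_eq)
    show "T t x \<in> C" using that by (simp add: TC)
    show "is_mean_integral \<mu> (\<lambda>s. T s (T t x)) (mean_map \<mu> T x)"
      unfolding is_mean_integral_def
    proof
      fix f :: "'e \<Rightarrow> real" assume f: "f \<in> topological_dual"
      \<comment> \<open>The representation property turns \<open>T s (T t x)\<close> into
        \<open>T (s * t) x\<close>, which is right translation by \<open>t\<close>.\<close>
      have "(\<lambda>s. f (T s (T t x))) = right_translate t (\<lambda>s. f (T s x))"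
        using assms(8) that(2) by (simp add: representation_def right_translate_def)
      with intg[OF that(2)] f X[OF that(2) f] that(1)
      show "f (mean_map \<mu> T x) = \<mu> (\<lambda>s. f (T s (T t x)))"
        by (simp add: is_mean_integral_def right_invariant_def)
    qed
  qed
  moreover have "attractive_point Q C (mean_map \<mu> T) a" if "attractive_point_family Q C T a" for a
    unfolding attractive_point_def
  proof (intro ballI)
    fix x q assume x: "x \<in> C" and q: "q \<in> Q"
    obtain W where W: "W \<in> \<B>" "q = minkowski W" using q assms(7) by auto
    have "q (a - T t x) \<le> q (a - x)" for t
      using that x q by (simp add: attractive_point_family_def)
    \<comment> \<open>The constant family \<open>a\<close> has integral \<open>a\<close>, so the
      difference estimate applies to it and \<open>T t x\<close>.\<close>
    with W show "q (a - mean_map \<mu> T x) \<le> q (a - x)"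
      using minkowski_is_mean_integral_diff_le[OF is_mean_integral_const X_const intg[OF x] X[OF x] V[OF W(1)]]
      by blast
  qed
  ultimately show ?thesis by blast
qed

end
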